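(* Let $C,\rho,H\in\mathbb{R}$ with $\rho\neq0$. Then the ($t$-independent) functions $$u=w_x=\frac{C^2\frac{\rho^2}{12}-12C^4(x+H)^2}{\left[\left(\frac{\rho}{12}\right)^2+C^2(x+H)^2\right]^2},\qquad v=y_x=\frac{-2C^3\rho(x+H)}{\left[\left(\frac{\rho}{12}\right)^2+C^2(x+H)^2\right]^2}$$ are solutions of the system $$u_t+uu_x+u_{xxx}-vv_x=0,\qquad v_t+u_xv+v_xu+v_{xxx}=0,$$ corresponding to $\eta=0$ in the Bäcklund transformation; that is, $u=w_x$ and $v=y_x$ for the pair $$w=\frac{12C^2(x+H)}{\left(\frac{\rho}{12}\right)^2+C^2(x+H)^2},\qquad y=\frac{C\rho}{\left(\frac{\rho}{12}\right)^2+C^2(x+H)^2},$$ which satisfies the Bäcklund transformation from the trivial solution $(w',y')=(0,0)$ with $\lambda=-1$, $\mu=0$ and $\eta=0$.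
   Context: The system is the case $\lambda=-1$ of $u_t+uu_x+u_{xxx}+\lambda vv_x=0$, $v_t+u_xv+v_xu+v_{xxx}=0$. The Bäcklund transformation from $(w',y')=(0,0)$ with $\lambda=-1$, $\mu=0$ and parameter $\eta$ consists of the equations $$w_x=2\eta-\tfrac1{12}w^2+\tfrac1{12}y^2,\qquad w_t=\tfrac16ww_{xx}-\tfrac16yy_{xx}-\tfrac13w_x^2+\tfrac13y_x^2,$$ $$y_x=-\tfrac16wy,\qquad y_t=\tfrac16wy_{xx}+\tfrac16w_{xx}y-\tfrac23w_xy_x .$$ *)

theory Defs
  imports "HOL-Analysis.Analysis"
begin

text \<open>Functions of space and time are curried: \<open>f x t\<close>.\<close>

definition pdx :: "(real \<Rightarrow> real \<Rightarrow> real) \<Rightarrow> real \<Rightarrow> real \<Rightarrow> real" where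
  "pdx f x t = deriv (\<lambda>s. f s t) x"

definition pdt :: "(real \<Rightarrow> real \<Rightarrow> real) \<Rightarrow> real \<Rightarrow> real \<Rightarrow> real" where
  "pdt f x t = deriv (\<lambda>s. f x s) t"

text \<open>
  \<open>deriv\<close> is a total operator, so the existence of the derivatives has to be required separately.
  \<open>classC n f\<close>: \<open>f\<close> has \<open>x\<close>-derivatives up to order \<open>n\<close> and a first \<open>t\<close>-derivative on the whole
  plane, all of them jointly continuous.
\<close>

definition classC :: "nat \<Rightarrow> (real \<Rightarrow> real \<Rightarrow> real) \<Rightarrow> bool" where
  "classC n f \<longleftrightarrow>
     (\<forall>k<n. \<forall>x t. (\<lambda>s. (pdx ^^ k) f s t) differentiable (at x)) \<and>
     (\<forall>k\<le>n. continuous_on UNIV (\<lambda>(x, t). (pdx ^^ k) f x t)) \<and>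
     (\<forall>x t. (\<lambda>s. f x s) differentiable (at t)) \<and>
     continuous_on UNIV (\<lambda>(x, t). pdt f x t)"

text \<open>Classical solutions of the coupled KdV system with coupling constant \<open>\<lambda>\<close> (here \<open>l\<close>).\<close>

definition coupled_KdV_solution ::
  "real \<Rightarrow> (real \<Rightarrow> real \<Rightarrow> real) \<Rightarrow> (real \<Rightarrow> real \<Rightarrow> real) \<Rightarrow> bool" where
  "coupled_KdV_solution l u v \<longleftrightarrow>
     classC 3 u \<and> classC 3 v \<and>
     (\<forall>x t. pdt u x t + u x t * pdx u x t + pdx (pdx (pdx u)) x t + l * v x t * pdx v x t = 0) \<and>
     (\<forall>x t. pdt v x t + pdx u x t * v x t + pdx v x t * u x t + pdx (pdx (pdx v)) x t = 0)"

text \<open>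
  The Baecklund transformation with \<open>\<lambda> = -1\<close>, \<open>\<mu> = 0\<close> and parameter \<open>\<eta>\<close>, taken from the trivial
  solution \<open>(w', y') = (0, 0)\<close>.
\<close>

definition Baecklund_from_zero ::
  "real \<Rightarrow> (real \<Rightarrow> real \<Rightarrow> real) \<Rightarrow> (real \<Rightarrow> real \<Rightarrow> real) \<Rightarrow> bool" where
  "Baecklund_from_zero \<eta> w y \<longleftrightarrow>
     classC 2 w \<and> classC 2 y \<and>
     (\<forall>x t. pdx w x t = 2 * \<eta> - 1/12 * (w x t)\<^sup>2 + 1/12 * (y x t)\<^sup>2) \<and>
     (\<forall>x t. pdt w x t = 1/6 * w x t * pdx (pdx w) x t - 1/6 * y x t * pdx (pdx y) x t
                        - 1/3 * (pdx w x t)\<^sup>2 + 1/3 * (pdx y x t)\<^sup>2) \<and>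
     (\<forall>x t. pdx y x t = - (1/6) * w x t * y x t) \<and>
     (\<forall>x t. pdt y x t = 1/6 * w x t * pdx (pdx y) x t + 1/6 * pdx (pdx w) x t * y x t
                        - 2/3 * pdx w x t * pdx y x t)"

end

theory Submission
  imports Defs
begin

text \<open>
  Put \<open>W = w + \<i> y\<close>. For \<open>\<eta> = 0\<close> the \<open>x\<close>-part of the Baecklund transformation is the real form of
  the Riccati equation \<open>W' = - W\<^sup>2 / 12\<close>, so the \<open>k\<close>-th derivative of \<open>W\<close> is
  \<open>(- 1/12)\<^sup>k k! W\<^sup>k\<^sup>+\<^sup>1\<close>. As nothing depends on \<open>t\<close>, the \<open>t\<close>-part reads \<open>W W'' = 2 W'\<^sup>2\<close> and the
  system for \<open>Z = u + \<i> v = W'\<close> is the stationary complex KdV equation \<open>Z Z' + Z''' = 0\<close>; both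
  become identities between powers of \<open>W\<close>. Working with \<open>W\<close> instead of \<open>12 / (x + H - \<i> \<rho> / (12 C))\<close>
  covers \<open>C = 0\<close> as well.
\<close>

lemma pdx_stationary:
  assumes "\<And>x. (f has_real_derivative f' x) (at x)"
  shows "pdx (\<lambda>x t. f x) = (\<lambda>x t. f' x)"
  using assms by (simp add: pdx_def fun_eq_iff DERIV_imp_deriv)

lemma pdt_stationary: "pdt (\<lambda>x t. f x) = (\<lambda>x t. 0)"
  by (simp add: pdt_def fun_eq_iff)

lemma pdx_funpow_stationary:
  assumes "\<And>k x. (F k has_real_derivative F (Suc k) x) (at x)"
  shows "(pdx ^^ k) (\<lambda>x t. F m x) = (\<lambda>x t. F (m + k) x)"
  by (induction k) (simp_all add: pdx_stationary[OF assms])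

text \<open>In a sequence closed under differentiation every iterate of \<open>pdx\<close> is again
  a member, and each member is continuous because it is differentiable. This settles all orders
  \<open>n\<close> at once.\<close>

lemma classC_stationary:
  assumes F: "\<And>k x. (F k has_real_derivative F (Suc k) x) (at x)"
  shows "classC n (\<lambda>x t. F m x)"
proof -
  have "continuous_on UNIV (\<lambda>p :: real \<times> real. F k (fst p))" for k
  proof (rule continuous_on_compose2[of UNIV "F k"])
    show "continuous_on UNIV (F k)"
      using F by (meson DERIV_isCont continuous_at_imp_continuous_on)
  qed (auto intro: continuous_intros)
  moreover have "F k differentiable (at x)" for k x
    using F real_differentiable_def by blast
  ultimately show ?thesis
    by (simp add: classC_def pdx_funpow_stationary[of F, OF F] pdt_stationary case_prod_unfold)
qed

definition riccati_deriv :: "(real \<Rightarrow> complex) \<Rightarrow> nat \<Rightarrow> real \<Rightarrow> complex" where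
  "riccati_deriv W k x = of_real ((- 1 / 12) ^ k * fact k) * W x ^ Suc k"

text \<open>Chain rule: differentiating the power gives the factor \<open>Suc k\<close>, and the
  Riccati equation supplies \<open>- 1 / 12\<close> and two more powers of \<open>W\<close>.\<close>

lemma riccati_deriv_has_vector_derivative:
  assumes "(W has_vector_derivative - (W x)\<^sup>2 / 12) (at x)"
  shows "(riccati_deriv W k has_vector_derivative riccati_deriv W (Suc k) x) (at x)"
proof -
  let ?c = "of_real ((- 1 / 12) ^ k * fact k) :: complex"
  have "((\<lambda>z. ?c * z ^ Suc k) has_field_derivative ?c * (of_nat (Suc k) * W x ^ k)) (at (W x))"
    by (rule DERIV_cmult) (use DERIV_power[OF DERIV_ident, where n = "Suc k"] in simp)
  from field_vector_diff_chain_at[OF assms this] show ?thesis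
    by (simp add: riccati_deriv_def[abs_def] o_def field_simps power2_eq_square)
qed

lemma
  assumes "\<And>x. (W has_vector_derivative - (W x)\<^sup>2 / 12) (at x)"
  shows Re_riccati_deriv_has_real_derivative:
      "((\<lambda>x. Re (riccati_deriv W k x)) has_real_derivative Re (riccati_deriv W (Suc k) x)) (at x)"
    and Im_riccati_deriv_has_real_derivative:
      "((\<lambda>x. Im (riccati_deriv W k x)) has_real_derivative Im (riccati_deriv W (Suc k) x)) (at x)"
  using riccati_deriv_has_vector_derivative[OF assms]
  by (auto simp: has_vector_derivative_complex_iff)

lemma riccati_solution:
  fixes W :: "real \<Rightarrow> complex"
  assumes W: "\<And>x. (W has_vector_derivative - (W x)\<^sup>2 / 12) (at x)"
  defines "w \<equiv> \<lambda>x t. Re (W x)" and "y \<equiv> \<lambda>x t. Im (W x)"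
  shows "Baecklund_from_zero 0 w y" "coupled_KdV_solution (- 1) (pdx w) (pdx y)"
proof -
  let ?R = "\<lambda>k x. Re (riccati_deriv W k x)" and ?I = "\<lambda>k x. Im (riccati_deriv W k x)"
  note R = Re_riccati_deriv_has_real_derivative[of W, OF W]
    and I = Im_riccati_deriv_has_real_derivative[of W, OF W]
  \<comment> \<open>The coefficient at index 0 is 1, so \<open>W\<close> heads the sequence and each
    \<open>pdx\<close> merely raises the index.\<close>
  have w: "w = (\<lambda>x t. ?R 0 x)" and y: "y = (\<lambda>x t. ?I 0 x)"
    by (simp_all add: w_def y_def riccati_deriv_def)
  note pdx_R = pdx_stationary[OF R] and pdx_I = pdx_stationary[OF I]
  note cls = classC_stationary[of ?R, OF R] classC_stationary[of ?I, OF I]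
  show "Baecklund_from_zero 0 w y"
    unfolding Baecklund_from_zero_def w y pdx_R pdx_I pdt_stationary
    by (intro conjI allI cls; simp add: riccati_deriv_def power2_eq_square; simp add: field_simps)
  show "coupled_KdV_solution (- 1) (pdx w) (pdx y)"
    unfolding coupled_KdV_solution_def w y pdx_R pdx_I pdt_stationary
    by (intro conjI allI cls; simp add: riccati_deriv_def power2_eq_square; simp add: field_simps)
qed

theorem proposition3:
  fixes C \<rho> H :: real and u v w y :: "real \<Rightarrow> real \<Rightarrow> real"
  assumes "\<rho> \<noteq> 0"
    and "\<And>x t. u x t = (C^2 * (\<rho>^2 / 12) - 12 * C^4 * (x + H)^2) / ((\<rho> / 12)^2 + C^2 * (x + H)^2)^2"
    and "\<And>x t. v x t = (- 2 * C^3 * \<rho> * (x + H)) / ((\<rho> / 12)^2 + C^2 * (x + H)^2)^2"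
    and "\<And>x t. w x t = (12 * C^2 * (x + H)) / ((\<rho> / 12)^2 + C^2 * (x + H)^2)"
    and "\<And>x t. y x t = (C * \<rho>) / ((\<rho> / 12)^2 + C^2 * (x + H)^2)"
  shows "coupled_KdV_solution (- 1) u v \<and>
         u = pdx w \<and> v = pdx y \<and>
         Baecklund_from_zero 0 w y"
proof -
  define D where "D x = (\<rho> / 12)^2 + C^2 * (x + H)^2" for x
  \<comment> \<open>For nonzero \<open>C\<close> this is the reciprocal form
    \<open>12 / (x + H - \<i> \<rho> / (12 C))\<close> with real denominator; for
    \<open>C = 0\<close> it vanishes.\<close>
  define W where "W x = Complex (12 * C^2 * (x + H) / D x) (C * \<rho> / D x)" for x
  have D_nz: "D x \<noteq> 0" for x
    using \<open>\<rho> \<noteq> 0\<close> by (simp add: D_def sum_power2_eq_zero_iff flip: power_mult_distrib)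
  have D': "(D has_real_derivative 2 * C^2 * (x + H)) (at x)" for x
    unfolding D_def[abs_def] by (auto intro!: derivative_eq_intros)
  \<comment> \<open>The stated \<open>u\<close> and \<open>v\<close> are the real and imaginary
    parts of \<open>- W\<^sup>2 / 12\<close>. Once they are also shown to be the derivatives of
    \<open>Re W\<close> and \<open>Im W\<close>, the Riccati equation follows.\<close>
  have u: "u = (\<lambda>x t. ((Im (W x))\<^sup>2 - (Re (W x))\<^sup>2) / 12)"
    unfolding fun_eq_iff assms(2) D_def[symmetric]
    by (simp add: W_def power_divide power_mult_distrib diff_divide_distrib)
  have v: "v = (\<lambda>x t. - Re (W x) * Im (W x) / 6)"
    unfolding fun_eq_iff assms(3) D_def[symmetric]
    by (simp add: W_def power2_eq_square power3_eq_cube)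
  have w: "w = (\<lambda>x t. Re (W x))" and y: "y = (\<lambda>x t. Im (W x))"
    by (simp_all add: assms(4,5) W_def D_def fun_eq_iff)
  have Re': "((\<lambda>x. Re (W x)) has_real_derivative u x t) (at x)" for x t
  proof -
    have "((\<lambda>x. 12 * C^2 * (x + H) / D x) has_real_derivative
        (12 * C^2 * D x - 12 * C^2 * (x + H) * (2 * C^2 * (x + H))) / (D x * D x)) (at x)"
      using D_nz by (auto intro!: derivative_eq_intros D')
    also have "(12 * C^2 * D x - 12 * C^2 * (x + H) * (2 * C^2 * (x + H))) / (D x * D x) = u x t"
      unfolding assms(2) D_def[symmetric] power2_eq_square[of "D x"]
      \<comment> \<open>Both fractions have the denominator \<open>D x * D x\<close>, so comparing
        numerators suffices.\<close>
      by (rule arg_cong2[where f = "(/)"]) (simp_all add: D_def power2_eq_square power4_eq_xxxx algebra_simps)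
    finally show ?thesis by (simp add: W_def)
  qed
  have Im': "((\<lambda>x. Im (W x)) has_real_derivative v x t) (at x)" for x t
  proof -
    have "((\<lambda>x. C * \<rho> / D x) has_real_derivative
        (- (C * \<rho> * (2 * C^2 * (x + H)))) / (D x * D x)) (at x)"
      using D_nz by (auto intro!: derivative_eq_intros D')
    also have "(- (C * \<rho> * (2 * C^2 * (x + H)))) / (D x * D x) = v x t"
      unfolding assms(3) D_def[symmetric] power2_eq_square[of "D x"]
      by (rule arg_cong2[where f = "(/)"]) (simp_all, algebra)
    finally show ?thesis by (simp add: W_def)
  qed
  have "(W has_vector_derivative - (W x)\<^sup>2 / 12) (at x)" for x
    using Re'[of x] Im'[of x] unfolding u v
    by (simp add: has_vector_derivative_complex_iff power2_eq_square diff_divide_distrib mult.commute)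
  from riccati_solution[of W, OF this]
  have "Baecklund_from_zero 0 w y" "coupled_KdV_solution (- 1) (pdx w) (pdx y)"
    unfolding w y .
  moreover have "pdx w = u" "pdx y = v"
    unfolding w y using pdx_stationary[OF Re'] pdx_stationary[OF Im'] by (auto simp: u v)
  ultimately show ?thesis by simp
qed

end
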